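(* Let $G$ be a bridgeless cubic graph, let $M$ be a perfect matching of $G$, and let $\mathcal M=\{A,B,C,D\}$ be an F-family for $M$. Then $G$ has a Fulkerson covering.
   Context: A Fulkerson covering of $G$ is a family of $6$ perfect matchings of $G$ (not necessarily distinct) such that every edge lies in exactly two of them. Let $M$ be a perfect matching of $G$; the cycles of $G\setminus M$ are the cycles of the $2$-factor obtained by deleting the edges of $M$. A set $X\subseteq E(G)$ is an $M$-balanced matching if there is a perfect matching $M_X$ of $G$ with $X=M\cap M_X$. Four pairwise disjoint $M$-balanced matchings $\mathcal M=\{A,B,C,D\}$ form an F-family for $M$ if: (i) for every odd cycle $\Gamma$ of $G\setminus M$ and every $X\in\mathcal M$, exactly one vertex of $\Gamma$ is incident with an edge of $X$ (so $\Gamma$ has exactly four vertices incident with edges of $A\cup B\cup C\cup D$, one for each member); (ii) every even cycle $\Gamma$ of $G\setminus M$ having a vertex incident with an edge of $A\cup B\cup C\cup D$ has exactly four such vertices, and either two of them are incident with edges of one member of $\mathcal M$ and the other two with edges of another member of $\mathcal M$, or all four are incident with edges of the same member of $\mathcal M$; (iii) for every cycle $\Gamma$ of $G\setminus M$ as in (i) or (ii), the subgraph of $G$ induced by the four vertices so determined has a perfect matching (a matching with two edges covering these four vertices). The set of edges of these chosen two-edge matchings, over all such cycles, is denoted $N$. *)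

theory Defs
  imports Main
begin

text \<open>Finite undirected graphs with parallel edges allowed. Loops are excluded: a cubic graph
  with a loop has a bridge, so they cannot occur in a bridgeless cubic graph.\<close>

record ('v, 'e) graph =
  verts :: "'v set"
  edges :: "'e set"
  ends :: "'e \<Rightarrow> 'v set"

definition wf_graph :: "('v, 'e) graph \<Rightarrow> bool" where
  "wf_graph G \<longleftrightarrow> finite (verts G) \<and> finite (edges G) \<and>
     (\<forall>e\<in>edges G. ends G e \<subseteq> verts G \<and> card (ends G e) = 2)"

definition cubic :: "('v, 'e) graph \<Rightarrow> bool" where
  "cubic G \<longleftrightarrow> (\<forall>v\<in>verts G. card {e \<in> edges G. v \<in> ends G e} = 3)"

definition delete_edges :: "('v, 'e) graph \<Rightarrow> 'e set \<Rightarrow> ('v, 'e) graph" where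
  "delete_edges G F = G\<lparr>edges := edges G - F\<rparr>"

definition induced_subgraph :: "('v, 'e) graph \<Rightarrow> 'v set \<Rightarrow> ('v, 'e) graph" where
  "induced_subgraph G S =
     G\<lparr>verts := verts G \<inter> S, edges := {e \<in> edges G. ends G e \<subseteq> S}\<rparr>"

definition connected_rel :: "('v, 'e) graph \<Rightarrow> ('v \<times> 'v) set" where
  "connected_rel G =
     (verts G \<times> verts G) \<inter> {(u, v). \<exists>e\<in>edges G. ends G e = {u, v}}\<^sup>*"

definition components :: "('v, 'e) graph \<Rightarrow> 'v set set" where
  "components G = verts G // connected_rel G"

definition bridge :: "('v, 'e) graph \<Rightarrow> 'e \<Rightarrow> bool" where
  "bridge G e \<longleftrightarrow>
     e \<in> edges G \<and> card (components (delete_edges G {e})) > card (components G)"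

definition bridgeless :: "('v, 'e) graph \<Rightarrow> bool" where
  "bridgeless G \<longleftrightarrow> \<not> (\<exists>e. bridge G e)"

definition perfect_matching :: "('v, 'e) graph \<Rightarrow> 'e set \<Rightarrow> bool" where
  "perfect_matching G P \<longleftrightarrow>
     P \<subseteq> edges G \<and> (\<forall>v\<in>verts G. \<exists>!e. e \<in> P \<and> v \<in> ends G e)"

definition fulkerson_covering :: "('v, 'e) graph \<Rightarrow> (nat \<Rightarrow> 'e set) \<Rightarrow> bool" where
  "fulkerson_covering G P \<longleftrightarrow>
     (\<forall>i<6. perfect_matching G (P i)) \<and>
     (\<forall>e\<in>edges G. card {i. i < 6 \<and> e \<in> P i} = 2)"

text \<open>A cycle is given by its vertices \<open>vs\<close> and edges \<open>es\<close> in cyclic order, the edge \<open>es ! i\<close>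
  joining \<open>vs ! i\<close> to its successor. Two parallel edges form a cycle of length 2.\<close>

definition is_cycle :: "('v, 'e) graph \<Rightarrow> 'v list \<Rightarrow> 'e list \<Rightarrow> bool" where
  "is_cycle G vs es \<longleftrightarrow>
     length vs \<ge> 2 \<and> length es = length vs \<and> distinct vs \<and> distinct es \<and>
     set vs \<subseteq> verts G \<and> set es \<subseteq> edges G \<and>
     (\<forall>i<length vs. ends G (es ! i) = {vs ! i, vs ! (Suc i mod length vs)})"

definition balanced_matching :: "('v, 'e) graph \<Rightarrow> 'e set \<Rightarrow> 'e set \<Rightarrow> bool" where
  "balanced_matching G M X \<longleftrightarrow> (\<exists>MX. perfect_matching G MX \<and> X = M \<inter> MX)"

definition covered :: "('v, 'e) graph \<Rightarrow> 'e set \<Rightarrow> 'v set" where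
  "covered G X = (\<Union>e\<in>X. ends G e)"

text \<open>Members of the family may be empty, so that \<open>{A, B, C, D}\<close> may have fewer than four
  elements. Where two distinct members \<open>X\<close>, \<open>Y\<close> are required below, both are nonempty, hence
  distinct as sets.\<close>

definition F_family ::
  "('v, 'e) graph \<Rightarrow> 'e set \<Rightarrow> 'e set \<Rightarrow> 'e set \<Rightarrow> 'e set \<Rightarrow> 'e set \<Rightarrow> bool" where
  "F_family G M A B C D \<longleftrightarrow>
     (\<forall>X\<in>{A, B, C, D}. balanced_matching G M X) \<and>
     A \<inter> B = {} \<and> A \<inter> C = {} \<and> A \<inter> D = {} \<and> B \<inter> C = {} \<and> B \<inter> D = {} \<and> C \<inter> D = {} \<and>
     (\<forall>vs es. is_cycle (delete_edges G M) vs es \<and> odd (length vs) \<longrightarrow>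
        (\<forall>X\<in>{A, B, C, D}. card (set vs \<inter> covered G X) = 1)) \<and>
     (\<forall>vs es. is_cycle (delete_edges G M) vs es \<and> even (length vs) \<and>
          set vs \<inter> covered G (A \<union> B \<union> C \<union> D) \<noteq> {} \<longrightarrow>
        card (set vs \<inter> covered G (A \<union> B \<union> C \<union> D)) = 4 \<and>
        ((\<exists>X\<in>{A, B, C, D}. \<exists>Y\<in>{A, B, C, D}. X \<noteq> Y \<and>
            card (set vs \<inter> covered G X) = 2 \<and> card (set vs \<inter> covered G Y) = 2) \<or>
         (\<exists>X\<in>{A, B, C, D}. card (set vs \<inter> covered G X) = 4))) \<and>
     (\<forall>vs es. is_cycle (delete_edges G M) vs es \<and>
          (odd (length vs) \<or> set vs \<inter> covered G (A \<union> B \<union> C \<union> D) \<noteq> {}) \<longrightarrow>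
        (\<exists>N. perfect_matching
               (induced_subgraph G (set vs \<inter> covered G (A \<union> B \<union> C \<union> D))) N))"

end

theory Submission
  imports Defs "HOL-Library.Disjoint_Sets"
begin

text \<open>
  Let \<open>H = G \ M\<close>, let \<open>X 0, \<dots>, X 3\<close> be the members of the F-family, and let \<open>U\<close> be their
  union. The covering consists of \<open>M\<close>, of \<open>(M - U) \<union> N\<close>, and of four perfect matchings
  \<open>(X k - N) \<union> Q k\<close>, where the matching \<open>Q k\<close> of \<open>H\<close> is chosen cycle by cycle. Every edge of \<open>M\<close> is
  then covered twice, whatever the choices. For an edge \<open>e\<close> of \<open>H\<close>, count the \<open>Q k\<close> containing \<open>e\<close>,
  plus one if \<open>e \<in> N\<close>: at every vertex the counts of its two edges in \<open>H\<close> add up to 4. On an odd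
  cycle this forces the count 2. On an even cycle the counts alternate between two values. There
  each member covers an even number of vertices and all of them together cover at most four, so
  two members avoid the cycle, and their \<open>Q k\<close> can be switched between the two alternating classes
  until the count is 2.
\<close>

section \<open>Matchings\<close>

definition matching :: "('v, 'e) graph \<Rightarrow> 'e set \<Rightarrow> bool" where
  "matching G P \<longleftrightarrow> P \<subseteq> edges G \<and> disjoint_family_on (ends G) P"

lemma matching_edges: "matching G P \<Longrightarrow> P \<subseteq> edges G"
  by (simp add: matching_def)

lemma matching_eqI:
  assumes "matching G P" "e \<in> P" "f \<in> P" "v \<in> ends G e" "v \<in> ends G f"
  shows "e = f"
  using assms by (auto simp: matching_def disjoint_family_on_def)

lemma matching_subset: "matching G P \<Longrightarrow> Q \<subseteq> P \<Longrightarrow> matching G Q"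
  using disjoint_family_on_mono by (auto simp: matching_def)

lemma covered_mono: "P \<subseteq> Q \<Longrightarrow> covered G P \<subseteq> covered G Q"
  by (auto simp: covered_def)

lemma covered_Un: "covered G (P \<union> Q) = covered G P \<union> covered G Q"
  by (auto simp: covered_def)

lemma covered_UN: "covered G (\<Union>i\<in>I. P i) = (\<Union>i\<in>I. covered G (P i))"
  by (auto simp: covered_def)

lemma covered_Diff:
  assumes "matching G P" "Q \<subseteq> P"
  shows "covered G (P - Q) = covered G P - covered G Q"
proof -
  have "v \<notin> ends G f" if "e \<in> P - Q" "v \<in> ends G e" "f \<in> Q" for e f v
    using matching_eqI[OF assms(1)] assms(2) that by blast
  then show ?thesis
    unfolding covered_def by blast
qed

lemma covered_Int_disjoint:
  assumes "matching G P" "Q \<subseteq> P" "R \<subseteq> P" "Q \<inter> R = {}"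
  shows "covered G Q \<inter> covered G R = {}"
proof -
  have "covered G R \<subseteq> covered G (P - Q)"
    using assms(3,4) by (intro covered_mono) blast
  then show ?thesis
    using covered_Diff[OF assms(1,2)] by blast
qed

lemma matching_Un:
  assumes "matching G P" "matching G Q" "covered G P \<inter> covered G Q = {}"
  shows "matching G (P \<union> Q)"
  using assms unfolding matching_def covered_def disjoint_family_on_def by blast

lemma matching_UN:
  assumes "\<And>i. i \<in> I \<Longrightarrow> matching G (P i)" "disjoint_family_on (\<lambda>i. covered G (P i)) I"
  shows "matching G (\<Union>i\<in>I. P i)"
  unfolding matching_def
proof
  show "(\<Union>i\<in>I. P i) \<subseteq> edges G"
    using assms(1) matching_edges by blast
  show "disjoint_family_on (ends G) (\<Union>i\<in>I. P i)"
    unfolding disjoint_family_on_def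
  proof (intro ballI impI)
    fix e f assume "e \<in> (\<Union>i\<in>I. P i)" "f \<in> (\<Union>i\<in>I. P i)" and "e \<noteq> f"
    then obtain i j where ij: "i \<in> I" "e \<in> P i" "j \<in> I" "f \<in> P j" by blast
    show "ends G e \<inter> ends G f = {}"
    proof (cases "i = j")
      case True
      then show ?thesis
        using matching_eqI[OF assms(1)] ij \<open>e \<noteq> f\<close> by blast
    next
      case False
      then have "covered G (P i) \<inter> covered G (P j) = {}"
        using assms(2) ij by (simp add: disjoint_family_on_def)
      then show ?thesis using ij by (auto simp: covered_def)
    qed
  qed
qed

lemma wf_graph_ends:
  assumes "wf_graph G" "e \<in> edges G"
  shows "ends G e \<subseteq> verts G" "card (ends G e) = 2" "finite (ends G e)" "ends G e \<noteq> {}"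
proof -
  show "ends G e \<subseteq> verts G" and two: "card (ends G e) = 2"
    using assms by (auto simp: wf_graph_def)
  show "finite (ends G e)" "ends G e \<noteq> {}"
    using two card.infinite by fastforce+
qed

lemma card_covered:
  assumes G: "wf_graph G" and P: "matching G P"
  shows "card (covered G P) = 2 * card P"
proof -
  have "finite P"
    using G matching_edges[OF P] finite_subset by (auto simp: wf_graph_def)
  moreover have "\<forall>e\<in>P. finite (ends G e)" "\<forall>e\<in>P. card (ends G e) = 2"
    using wf_graph_ends[OF G] matching_edges[OF P] by auto
  moreover have "\<forall>e\<in>P. \<forall>f\<in>P. e \<noteq> f \<longrightarrow> ends G e \<inter> ends G f = {}"
    using P by (simp add: matching_def disjoint_family_on_def)
  ultimately show ?thesis
    unfolding covered_def by (subst card_UN_disjoint) auto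
qed

lemma perfect_matching_iff:
  assumes "wf_graph G"
  shows "perfect_matching G P \<longleftrightarrow> matching G P \<and> covered G P = verts G"
proof
  assume P: "perfect_matching G P"
  then have sub: "P \<subseteq> edges G" and ex1: "\<And>v. v \<in> verts G \<Longrightarrow> \<exists>!e. e \<in> P \<and> v \<in> ends G e"
    by (auto simp: perfect_matching_def)
  have ends: "ends G e \<subseteq> verts G" if "e \<in> P" for e
    using wf_graph_ends(1)[OF assms] sub that by blast
  have "e = f" if "e \<in> P" "f \<in> P" "v \<in> ends G e" "v \<in> ends G f" for e f v
    using ex1[of v] ends that by blast
  then have "disjoint_family_on (ends G) P"
    unfolding disjoint_family_on_def by blast
  moreover have "covered G P = verts G"
  proof
    show "verts G \<subseteq> covered G P"
      using ex1_implies_ex[OF ex1] unfolding covered_def by blast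
  qed (use ends in \<open>auto simp: covered_def\<close>)
  ultimately show "matching G P \<and> covered G P = verts G"
    using sub by (simp add: matching_def)
next
  assume P: "matching G P \<and> covered G P = verts G"
  have "\<exists>!e. e \<in> P \<and> v \<in> ends G e" if "v \<in> verts G" for v
  proof -
    have "v \<in> covered G P"
      using P that by simp
    then obtain e where "e \<in> P" "v \<in> ends G e"
      by (auto simp: covered_def)
    then show ?thesis
      using P matching_eqI by metis
  qed
  then show "perfect_matching G P"
    using P by (simp add: perfect_matching_def matching_def)
qed

lemma perfect_matching_induced_iff:
  assumes "wf_graph G"
  shows "perfect_matching (induced_subgraph G W) P \<longleftrightarrow>
    matching G P \<and> covered G P = verts G \<inter> W"
proof -
  have "wf_graph (induced_subgraph G W)"
    using assms by (auto simp: wf_graph_def induced_subgraph_def)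
  moreover have "matching (induced_subgraph G W) P \<longleftrightarrow> matching G P \<and> covered G P \<subseteq> W"
    by (auto simp: matching_def induced_subgraph_def covered_def)
  moreover have "covered (induced_subgraph G W) P = covered G P"
    "verts (induced_subgraph G W) = verts G \<inter> W"
    by (simp_all add: covered_def induced_subgraph_def)
  ultimately show ?thesis
    by (auto simp: perfect_matching_iff)
qed

lemma verts_delete_edges [simp]: "verts (delete_edges G F) = verts G"
  and edges_delete_edges [simp]: "edges (delete_edges G F) = edges G - F"
  and ends_delete_edges [simp]: "ends (delete_edges G F) = ends G"
  by (simp_all add: delete_edges_def)

lemma wf_graph_delete_edges: "wf_graph G \<Longrightarrow> wf_graph (delete_edges G F)"
  by (simp add: wf_graph_def)

lemma covered_delete_edges [simp]: "covered (delete_edges G F) P = covered G P"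
  by (simp add: covered_def)

lemma matching_delete_edges: "matching (delete_edges G F) P \<longleftrightarrow> matching G P \<and> P \<inter> F = {}"
  by (auto simp: matching_def)

definition edge_closed :: "('v, 'e) graph \<Rightarrow> 'e set \<Rightarrow> 'v set \<Rightarrow> bool" where
  "edge_closed G P W \<longleftrightarrow> (\<forall>e\<in>P. ends G e \<inter> W \<noteq> {} \<longrightarrow> ends G e \<subseteq> W)"

lemma edge_closedD: "edge_closed G P W \<Longrightarrow> e \<in> P \<Longrightarrow> v \<in> ends G e \<Longrightarrow> v \<in> W \<Longrightarrow> ends G e \<subseteq> W"
  by (auto simp: edge_closed_def)

lemma covered_edges_within:
  assumes "edge_closed G P W"
  shows "covered G {e \<in> P. ends G e \<subseteq> W} = W \<inter> covered G P"
  using edge_closedD[OF assms] by (fastforce simp: covered_def)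

section \<open>Cycles of two-regular graphs\<close>

definition two_regular :: "('v, 'e) graph \<Rightarrow> bool" where
  "two_regular H \<longleftrightarrow> wf_graph H \<and> (\<forall>v\<in>verts H. card {e \<in> edges H. v \<in> ends H e} = 2)"

lemma two_regular_delete_perfect_matching:
  assumes "wf_graph G" "cubic G" "perfect_matching G M"
  shows "two_regular (delete_edges G M)"
  unfolding two_regular_def
proof (intro conjI ballI)
  show "wf_graph (delete_edges G M)"
    using assms(1) by (rule wf_graph_delete_edges)
  have M: "matching G M" "covered G M = verts G"
    using assms(1,3) by (simp_all add: perfect_matching_iff)
  fix v assume "v \<in> verts (delete_edges G M)"
  then have v: "v \<in> verts G" by simp
  then obtain m where m: "m \<in> M" "v \<in> ends G m"
    using M(2) by (auto simp: covered_def)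
  have "{e \<in> edges G - M. v \<in> ends G e} = {e \<in> edges G. v \<in> ends G e} - {m}"
    using m matching_eqI[OF M(1)] by blast
  moreover have "m \<in> {e \<in> edges G. v \<in> ends G e}"
    using m matching_edges[OF M(1)] by blast
  moreover have "card {e \<in> edges G. v \<in> ends G e} = 3"
    using assms(2) v by (simp add: cubic_def)
  ultimately show "card {e \<in> edges (delete_edges G M). v \<in> ends (delete_edges G M) e} = 2"
    by simp
qed

lemma two_regular_edges_at:
  assumes "two_regular H" "v \<in> verts H" "a \<noteq> b"
    "a \<in> edges H" "v \<in> ends H a" "b \<in> edges H" "v \<in> ends H b"
  shows "{e \<in> edges H. v \<in> ends H e} = {a, b}"
proof -
  have two: "card {e \<in> edges H. v \<in> ends H e} = 2"
    using assms(1,2) by (simp add: two_regular_def)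
  then have "finite {e \<in> edges H. v \<in> ends H e}"
    by (intro card_ge_0_finite) simp
  then have "{a, b} = {e \<in> edges H. v \<in> ends H e}"
    using assms two by (intro card_subset_eq) auto
  then show ?thesis ..
qed

lemma two_regular_other_edge:
  assumes "two_regular H" "v \<in> verts H"
  obtains f w where "f \<in> edges H" "f \<noteq> e" "ends H f = {v, w}" "w \<in> verts H" "w \<noteq> v"
proof -
  have "card {f \<in> edges H. v \<in> ends H f} = 2"
    using assms by (simp add: two_regular_def)
  then obtain a b where "{f \<in> edges H. v \<in> ends H f} = {a, b}" "a \<noteq> b"
    by (auto simp: card_2_iff)
  then obtain f where f: "f \<in> edges H" "v \<in> ends H f" "f \<noteq> e" by blast
  moreover have "wf_graph H"
    using assms(1) by (simp add: two_regular_def)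
  then have "card (ends H f) = 2" "ends H f \<subseteq> verts H"
    by (rule wf_graph_ends[OF _ f(1)])+
  then obtain w where "ends H f = {v, w}" "w \<noteq> v" "w \<in> verts H"
    using f(2) by (fastforce simp: card_2_iff)
  ultimately show ?thesis
    using that by blast
qed

definition is_path :: "('v, 'e) graph \<Rightarrow> 'v list \<Rightarrow> 'e list \<Rightarrow> bool" where
  "is_path H vs es \<longleftrightarrow> length vs = Suc (length es) \<and> distinct vs \<and> set vs \<subseteq> verts H \<and>
     (\<forall>i<length es. es ! i \<in> edges H \<and> ends H (es ! i) = {vs ! i, vs ! Suc i})"

lemma is_path_hd: "is_path H vs es \<Longrightarrow> hd vs = vs ! 0"
  by (cases vs) (auto simp: is_path_def)

lemma is_path_last: "is_path H vs es \<Longrightarrow> last vs = vs ! length es"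
  by (subst last_conv_nth) (auto simp: is_path_def)

lemma is_path_nth_eq_iff:
  assumes "is_path H vs es" "i \<le> length es" "j \<le> length es"
  shows "vs ! i = vs ! j \<longleftrightarrow> i = j"
  using assms by (simp add: is_path_def nth_eq_iff_index_eq)

lemma is_path_snoc:
  assumes "is_path H vs es" "f \<in> edges H" "ends H f = {last vs, w}" "w \<in> verts H" "w \<notin> set vs"
  shows "is_path H (vs @ [w]) (es @ [f])"
  using assms is_path_last[OF assms(1)]
  by (auto simp: is_path_def nth_append less_Suc_eq)

lemma is_path_distinct_edges:
  assumes "is_path H vs es"
  shows "distinct es"
  unfolding distinct_conv_nth
proof (intro allI impI notI)
  fix i j assume ij: "i < length es" "j < length es" "i \<noteq> j" "es ! i = es ! j"
  then have "{vs ! i, vs ! Suc i} = {vs ! j, vs ! Suc j}"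
    using assms by (metis is_path_def)
  then have "vs ! i = vs ! j \<or> vs ! i = vs ! Suc j \<and> vs ! Suc i = vs ! j"
    by (auto simp: doubleton_eq_iff)
  then show False
    using ij is_path_nth_eq_iff[OF assms] by auto
qed

lemma is_path_edge_at_last:
  assumes p: "is_path H vs es" and e: "e \<in> set es" "last vs \<in> ends H e"
  shows "e = last es"
proof -
  obtain i where i: "i < length es" "e = es ! i"
    using e(1) by (auto simp: in_set_conv_nth)
  then have "vs ! length es \<in> {vs ! i, vs ! Suc i}"
    using p e(2) is_path_last[OF p] by (simp add: is_path_def)
  then have "length es = Suc i"
    using i(1) is_path_nth_eq_iff[OF p] by auto
  then show ?thesis
    using i by (cases es rule: rev_cases) auto
qed

lemma is_path_inner_edges:
  assumes H: "two_regular H" and p: "is_path H vs es"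
    and i: "0 < i" "i < length es" and f: "f \<in> edges H" "vs ! i \<in> ends H f"
  shows "f \<in> set es"
proof -
  have e: "es ! j \<in> edges H" "ends H (es ! j) = {vs ! j, vs ! Suc j}" if "j < length es" for j
    using p that by (auto simp: is_path_def)
  have "es ! (i - 1) \<noteq> es ! i"
    using is_path_distinct_edges[OF p] i by (simp add: nth_eq_iff_index_eq)
  moreover have "vs ! i \<in> verts H"
    using p i by (auto simp: is_path_def)
  ultimately have "{e \<in> edges H. vs ! i \<in> ends H e} = {es ! (i - 1), es ! i}"
    using e[of "i - 1"] e[of i] i by (intro two_regular_edges_at[OF H]) auto
  then have "f \<in> {es ! (i - 1), es ! i}"
    using f by blast
  then show ?thesis
    using i by auto
qed

lemma is_cycle_close_path:
  assumes p: "is_path H vs es" and f: "f \<in> edges H" "f \<notin> set es" "ends H f = {last vs, hd vs}"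
    and ne: "es \<noteq> []"
  shows "is_cycle H vs (es @ [f])"
proof -
  have len: "length vs = Suc (length es)"
    using p by (simp add: is_path_def)
  have "ends H ((es @ [f]) ! i) = {vs ! i, vs ! (Suc i mod length vs)}" if "i < length vs" for i
  proof (cases "i < length es")
    case True
    then show ?thesis
      using p by (simp add: is_path_def nth_append)
  next
    case False
    then have "i = length es"
      using that len by simp
    then show ?thesis
      using f(3) len is_path_hd[OF p] is_path_last[OF p] by simp
  qed
  moreover have "set es \<subseteq> edges H"
    using p by (auto simp: is_path_def in_set_conv_nth)
  moreover have "2 \<le> length vs"
    using ne len by (cases es) auto
  ultimately show ?thesis
    using p f is_path_distinct_edges[OF p] by (auto simp: is_cycle_def is_path_def)
qed

lemma maximal_path_from:
  assumes fin: "finite (verts H)" and v: "v \<in> verts H"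
  obtains vs es where "is_path H vs es" "hd vs = v"
    "\<And>f w. f \<in> edges H \<Longrightarrow> ends H f = {last vs, w} \<Longrightarrow> w \<in> verts H \<Longrightarrow> w \<in> set vs"
proof -
  let ?path = "\<lambda>vs. (\<exists>es. is_path H vs es) \<and> hd vs = v"
  have "is_path H [v] []"
    using v by (simp add: is_path_def)
  then have "?path [v]" by auto
  moreover have "\<forall>vs. ?path vs \<longrightarrow> length vs < Suc (card (verts H))"
  proof (intro allI impI)
    fix vs assume "?path vs"
    then have "set vs \<subseteq> verts H" "distinct vs"
      by (auto simp: is_path_def)
    then show "length vs < Suc (card (verts H))"
      using card_mono[OF fin] by (metis distinct_card le_imp_less_Suc)
  qed
  ultimately have "\<exists>vs. ?path vs \<and> (\<forall>vs'. ?path vs' \<longrightarrow> length vs' \<le> length vs)"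
    by (rule ex_has_greatest_nat)
  then obtain vs es where p: "is_path H vs es" "hd vs = v"
    and longest: "\<forall>vs'. ?path vs' \<longrightarrow> length vs' \<le> length vs"
    by (elim exE conjE)
  show ?thesis
  proof (rule that[OF p], rule ccontr)
    fix f w assume "f \<in> edges H" "ends H f = {last vs, w}" "w \<in> verts H" "w \<notin> set vs"
    then have "is_path H (vs @ [w]) (es @ [f])"
      by (rule is_path_snoc[OF p(1)])
    moreover have "hd (vs @ [w]) = v"
      using p by (cases vs) (auto simp: is_path_def)
    ultimately show False
      using longest by fastforce
  qed
qed

lemma two_regular_cycle_through:
  assumes H: "two_regular H" and v: "v \<in> verts H"
  obtains vs es where "is_cycle H vs es" "v \<in> set vs"
proof -
  have "finite (verts H)"
    using H by (simp add: two_regular_def wf_graph_def)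
  then obtain vs es where p: "is_path H vs es" "hd vs = v"
    and max: "\<And>f w. f \<in> edges H \<Longrightarrow> ends H f = {last vs, w} \<Longrightarrow> w \<in> verts H \<Longrightarrow> w \<in> set vs"
    using maximal_path_from[OF _ v] by metis
  have len: "length vs = Suc (length es)" and "set vs \<subseteq> verts H" "vs \<noteq> []"
    using p(1) by (auto simp: is_path_def)
  then obtain f w where f: "f \<in> edges H" "f \<noteq> last es" "ends H f = {last vs, w}"
    and w: "w \<in> verts H" "w \<noteq> last vs"
    using two_regular_other_edge[OF H, of "last vs" "last es"] last_in_set by blast
  have f_new: "f \<notin> set es"
    using is_path_edge_at_last[OF p(1)] f by blast
  obtain i where i: "i \<le> length es" "w = vs ! i"
    using max[OF f(1,3) w(1)] len by (auto simp: in_set_conv_nth less_Suc_eq_le)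
  then have "i < length es"
    using w(2) is_path_last[OF p(1)] by (cases "i = length es") auto
  moreover from this have "i = 0"
    using is_path_inner_edges[OF H p(1), of i f] f f_new i(2) by auto
  ultimately have "is_cycle H vs (es @ [f])"
    using f f_new i(2) is_path_hd[OF p(1)] by (intro is_cycle_close_path[OF p(1)]) auto
  moreover have "v \<in> set vs"
    using p(2) \<open>vs \<noteq> []\<close> by auto
  ultimately show ?thesis
    by (rule that)
qed

definition cycle_sets :: "('v, 'e) graph \<Rightarrow> 'v set set" where
  "cycle_sets H = {set vs | vs es. is_cycle H vs es}"

locale two_regular_cycle =
  fixes H :: "('v, 'e) graph" and vs :: "'v list" and es :: "'e list"
  assumes two_regular: "two_regular H" and cycle: "is_cycle H vs es"
begin

lemma wf_H: "wf_graph H"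
  using two_regular by (simp add: two_regular_def)

lemma length_es: "length es = length vs"
  and distinct_es: "distinct es"
  and set_es_edges: "set es \<subseteq> edges H"
  and set_vs_verts: "set vs \<subseteq> verts H"
  and ends_nth: "i < length vs \<Longrightarrow> ends H (es ! i) = {vs ! i, vs ! (Suc i mod length vs)}"
  using cycle by (auto simp: is_cycle_def)

lemma Suc_mod_less: "i < length vs \<Longrightarrow> Suc i mod length vs < length vs"
  by (rule mod_less_divisor) linarith

lemma vertex_nth_SucE:
  assumes "v \<in> set vs"
  obtains j where "j < length vs" "v = vs ! (Suc j mod length vs)"
proof -
  obtain i where i: "i < length vs" "v = vs ! i"
    using assms by (auto simp: in_set_conv_nth)
  show ?thesis
  proof (cases i)
    case 0
    then show ?thesis using i that[of "length vs - 1"] by simp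
  next
    case (Suc j)
    then show ?thesis using i that[of j] by simp
  qed
qed

lemma edges_at:
  assumes j: "j < length vs"
  shows "es ! j \<noteq> es ! (Suc j mod length vs)"
    and "{e \<in> edges H. vs ! (Suc j mod length vs) \<in> ends H e} =
      {es ! j, es ! (Suc j mod length vs)}"
proof -
  let ?k = "Suc j mod length vs"
  have k: "?k < length vs"
    using j by (rule Suc_mod_less)
  have "length vs \<ge> 2"
    using cycle by (simp add: is_cycle_def)
  then have "j \<noteq> ?k"
    using j by (cases "Suc j = length vs") auto
  then show ne: "es ! j \<noteq> es ! ?k"
    using j k length_es distinct_es by (simp add: nth_eq_iff_index_eq)
  show "{e \<in> edges H. vs ! ?k \<in> ends H e} = {es ! j, es ! ?k}"
    using j k ends_nth set_es_edges set_vs_verts length_es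
    by (intro two_regular_edges_at[OF two_regular _ ne]) (auto intro: subsetD[OF _ nth_mem])
qed

lemma ends_subset: "e \<in> set es \<Longrightarrow> ends H e \<subseteq> set vs"
  using ends_nth Suc_mod_less length_es by (auto simp: in_set_conv_nth[of e])

lemma edge_at_mem:
  assumes "e \<in> edges H" "v \<in> ends H e" "v \<in> set vs"
  shows "e \<in> set es"
proof -
  obtain j where j: "j < length vs" "v = vs ! (Suc j mod length vs)"
    using assms(3) by (rule vertex_nth_SucE)
  then have "e \<in> {es ! j, es ! (Suc j mod length vs)}"
    using edges_at(2)[OF j(1)] assms(1,2) by blast
  then show ?thesis
    using j(1) Suc_mod_less length_es by auto
qed

lemma edge_closed_set_vs: "edge_closed H (edges H) (set vs)"
  using edge_at_mem ends_subset by (fastforce simp: edge_closed_def)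

lemma set_es_eq: "set es = {e \<in> edges H. ends H e \<subseteq> set vs}"
  using set_es_edges ends_subset edge_at_mem wf_graph_ends(4)[OF wf_H] by blast

lemma set_vs_subset:
  assumes "edge_closed H (edges H) W" "v \<in> set vs" "v \<in> W"
  shows "set vs \<subseteq> W"
proof -
  obtain j where j: "j < length vs" "v = vs ! j"
    using assms(2) by (auto simp: in_set_conv_nth)
  have rotate: "vs ! ((j + t) mod length vs) \<in> W" for t
  proof (induction t)
    case 0
    then show ?case using j assms(3) by simp
  next
    case (Suc t)
    let ?i = "(j + t) mod length vs"
    have i: "?i < length vs"
      using j(1) by (intro mod_less_divisor) linarith
    then have "es ! ?i \<in> edges H"
      using length_es set_es_edges by (metis nth_mem subsetD)
    then have "ends H (es ! ?i) \<subseteq> W"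
      using edge_closedD[OF assms(1) _ _ Suc] ends_nth[OF i] by blast
    then show ?case
      using ends_nth[OF i] by (simp add: mod_Suc_eq)
  qed
  show ?thesis
  proof
    fix w assume "w \<in> set vs"
    then obtain i where i: "i < length vs" "w = vs ! i"
      by (auto simp: in_set_conv_nth)
    then have "(j + (length vs - j + i)) mod length vs = i"
      using j(1) by simp
    then show "w \<in> W"
      using rotate[of "length vs - j + i"] i(2) by simp
  qed
qed

lemma of_bool_sum_at:
  assumes Q: "matching H Q" and j: "j < length vs"
  shows "of_bool (es ! j \<in> Q) + of_bool (es ! (Suc j mod length vs) \<in> Q) =
    (of_bool (vs ! (Suc j mod length vs) \<in> covered H Q) :: nat)"
proof -
  define v a b where "v = vs ! (Suc j mod length vs)"
    and "a = es ! j" and "b = es ! (Suc j mod length vs)"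
  have ab: "{e \<in> edges H. v \<in> ends H e} = {a, b}" "a \<noteq> b"
    using edges_at[OF j] by (simp_all add: v_def a_def b_def)
  have "\<not> (a \<in> Q \<and> b \<in> Q)"
    using matching_eqI[OF Q, of a b v] ab by blast
  moreover have "v \<in> covered H Q \<longleftrightarrow> a \<in> Q \<or> b \<in> Q"
    using ab(1) matching_edges[OF Q] by (auto simp: covered_def)
  ultimately show ?thesis
    by (fold v_def a_def b_def) auto
qed

lemma alternating_sum:
  fixes s :: "'e \<Rightarrow> nat"
  assumes s: "\<And>j. j < length vs \<Longrightarrow> s (es ! j) + s (es ! (Suc j mod length vs)) = m"
    and i: "i < length vs"
  shows "s (es ! i) = (if even i then s (es ! 0) else m - s (es ! 0))"
  using i
proof (induction i)
  case (Suc i)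
  have "s (es ! i) + s (es ! Suc i) = m"
    using s[of i] Suc.prems by simp
  moreover have "s (es ! 0) \<le> m"
    using s[of 0] Suc.prems by linarith
  ultimately show ?case
    using Suc by (auto split: if_splits)
qed simp

lemma odd_alternating_sum:
  fixes s :: "'e \<Rightarrow> nat"
  assumes odd: "odd (length vs)"
    and s: "\<And>j. j < length vs \<Longrightarrow> s (es ! j) + s (es ! (Suc j mod length vs)) = m"
    and e: "e \<in> set es"
  shows "2 * s e = m"
proof -
  have last: "length vs - 1 < length vs" "even (length vs - 1)" "Suc (length vs - 1) = length vs"
    using odd by (auto elim: oddE)
  then have "s (es ! (length vs - 1)) = s (es ! 0)"
    using alternating_sum[where s = s, OF s] by simp
  then have "2 * s (es ! 0) = m"
    using s[OF last(1)] unfolding last(3) by simp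
  moreover obtain i where "i < length vs" "e = es ! i"
    using e length_es by (auto simp: in_set_conv_nth)
  ultimately show ?thesis
    using alternating_sum[where s = s, OF s, of i] by auto
qed

definition parity_class :: "bool \<Rightarrow> 'e set" where
  "parity_class b = {es ! i | i. i < length vs \<and> even i = b}"

lemma parity_class_subset: "parity_class b \<subseteq> set es"
  using length_es by (auto simp: parity_class_def)

lemma nth_mem_parity_class:
  assumes "i < length vs"
  shows "es ! i \<in> parity_class b \<longleftrightarrow> even i = b"
  using assms distinct_es length_es by (auto simp: parity_class_def nth_eq_iff_index_eq)

lemma subset_parity_class:
  assumes "P \<subseteq> set es" "card P \<le> 1"
  obtains b where "P \<subseteq> parity_class b"
proof (cases "P = {}")
  case False
  have "finite P"
    using assms(1) finite_subset by blast
  then have "card P = 1"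
    using False assms(2) by (simp add: le_Suc_eq)
  then obtain f where f: "P = {f}"
    by (rule card_1_singletonE)
  then obtain i where i: "i < length vs" "f = es ! i"
    using assms(1) length_es by (auto simp: in_set_conv_nth)
  then have "P \<subseteq> parity_class (even i)"
    using f nth_mem_parity_class[OF i(1)] by simp
  then show ?thesis by (rule that)
qed (use that in auto)

lemma parity_class_at:
  assumes ev: "even (length vs)" and v: "v \<in> set vs"
  obtains e where "e \<in> parity_class b" "v \<in> ends H e"
    "\<And>f. f \<in> parity_class b \<Longrightarrow> v \<in> ends H f \<Longrightarrow> f = e"
proof -
  obtain j where j: "j < length vs" "v = vs ! (Suc j mod length vs)"
    using v by (rule vertex_nth_SucE)
  let ?k = "Suc j mod length vs"
  have "even ?k \<longleftrightarrow> odd j"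
    using ev by (simp add: dvd_mod_iff)
  then have "es ! ?k \<in> parity_class b \<longleftrightarrow> es ! j \<notin> parity_class b"
    using j(1) by (auto simp: nth_mem_parity_class Suc_mod_less)
  then consider (j) "es ! j \<in> parity_class b" "es ! ?k \<notin> parity_class b"
    | (k) "es ! ?k \<in> parity_class b" "es ! j \<notin> parity_class b" by blast
  moreover have "f = es ! j \<or> f = es ! ?k" if "f \<in> parity_class b" "v \<in> ends H f" for f
    using edges_at(2)[OF j(1)] j(2) that parity_class_subset set_es_edges by blast
  moreover have "v \<in> ends H (es ! j)" "v \<in> ends H (es ! ?k)"
    using edges_at(2)[OF j(1)] j(2) by blast+
  ultimately show ?thesis
    by cases (use that in metis)+
qed

lemma
  assumes ev: "even (length vs)"
  shows matching_parity_class: "matching H (parity_class b)"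
    and covered_parity_class: "covered H (parity_class b) = set vs"
proof -
  have ends: "ends H e \<subseteq> set vs" if "e \<in> parity_class b" for e
    using parity_class_subset ends_subset that by blast
  have "e = f" if "e \<in> parity_class b" "f \<in> parity_class b" "v \<in> ends H e" "v \<in> ends H f" for e f v
    using parity_class_at[OF ev, of v b] ends that by (metis subsetD)
  then have "disjoint_family_on (ends H) (parity_class b)"
    unfolding disjoint_family_on_def by blast
  then show "matching H (parity_class b)"
    using parity_class_subset set_es_edges by (auto simp: matching_def)
  show "covered H (parity_class b) = set vs"
    unfolding covered_def
  proof
    show "set vs \<subseteq> (\<Union>e\<in>parity_class b. ends H e)"
      using parity_class_at[OF ev] by blast
  qed (use ends in blast)
qed

lemma parity_class_balance:
  fixes y :: "'e \<Rightarrow> nat"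
  assumes y: "\<And>j. j < length vs \<Longrightarrow> y (es ! j) + y (es ! (Suc j mod length vs)) = 2"
  obtains b c where
    "\<And>e. e \<in> set es \<Longrightarrow> y e + of_bool (e \<in> parity_class b) + of_bool (e \<in> parity_class c) = 2"
proof -
  define y0 where "y0 = y (es ! 0)"
  have "0 < length vs"
    using cycle by (auto simp: is_cycle_def)
  then have "y0 \<in> {0, 1, 2}"
    using y[of 0] by (auto simp: y0_def)
  moreover have "y (es ! i) = (if even i then y0 else 2 - y0)" if "i < length vs" for i
    using alternating_sum[where s = y, OF y that] by (simp add: y0_def)
  ultimately have
    "y e + of_bool (e \<in> parity_class (y0 \<le> 1)) + of_bool (e \<in> parity_class (y0 = 0)) = 2"
    if "e \<in> set es" for e
    using that length_es by (auto simp: in_set_conv_nth nth_mem_parity_class)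
  then show ?thesis
    by (rule that)
qed

end

lemma edge_closed_cycle_sets:
  assumes "two_regular H" "V \<in> cycle_sets H"
  shows "edge_closed H (edges H) V"
proof -
  obtain vs es where "is_cycle H vs es" "V = set vs"
    using assms(2) by (auto simp: cycle_sets_def)
  then show ?thesis
    using two_regular_cycle.edge_closed_set_vs[of H vs es] assms(1)
    by (simp add: two_regular_cycle_def)
qed

lemma partition_on_cycle_sets:
  assumes H: "two_regular H"
  shows "partition_on (verts H) (cycle_sets H)"
proof (rule partition_onI)
  show "\<Union>(cycle_sets H) = verts H"
  proof
    show "\<Union>(cycle_sets H) \<subseteq> verts H"
      by (auto simp: cycle_sets_def is_cycle_def)
    show "verts H \<subseteq> \<Union>(cycle_sets H)"
    proof
      fix v assume "v \<in> verts H"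
      then obtain vs es where "is_cycle H vs es" "v \<in> set vs"
        by (rule two_regular_cycle_through[OF H])
      then show "v \<in> \<Union>(cycle_sets H)"
        by (auto simp: cycle_sets_def)
    qed
  qed
next
  show "{} \<notin> cycle_sets H"
    by (auto simp: cycle_sets_def is_cycle_def)
next
  have sub: "V \<subseteq> W" if VW: "V \<in> cycle_sets H" "W \<in> cycle_sets H" "V \<inter> W \<noteq> {}" for V W
  proof -
    obtain vs es where "is_cycle H vs es" "V = set vs"
      using VW(1) by (auto simp: cycle_sets_def)
    then show ?thesis
      using two_regular_cycle.set_vs_subset[of H vs es W] edge_closed_cycle_sets[OF H VW(2)] VW(3) H
      by (auto simp: two_regular_cycle_def)
  qed
  fix V W assume "V \<in> cycle_sets H" "W \<in> cycle_sets H" "V \<noteq> W"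
  then show "disjnt V W"
    using sub[of V W] sub[of W V] by (auto simp: disjnt_def)
qed

section \<open>Quadruples of matchings on a cycle\<close>

lemma sum_of_bool_disjoint_family:
  assumes "finite I" "disjoint_family_on S I"
  shows "(\<Sum>i\<in>I. of_bool (x \<in> S i)) = (of_bool (x \<in> (\<Union>i\<in>I. S i)) :: nat)"
proof (cases "x \<in> (\<Union>i\<in>I. S i)")
  case True
  then obtain k where k: "k \<in> I" "x \<in> S k" by blast
  then have "i \<in> I \<Longrightarrow> x \<in> S i \<longleftrightarrow> i = k" for i
    using assms(2) by (auto simp: disjoint_family_on_def)
  then have "(\<Sum>i\<in>I. of_bool (x \<in> S i)) = (\<Sum>i\<in>I. if i = k then 1 else 0 :: nat)"
    by (intro sum.cong) auto
  then show ?thesis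
    using True k(1) assms(1) by simp
qed auto

definition matchings_avoiding ::
  "('v, 'e) graph \<Rightarrow> 'v set \<Rightarrow> (nat \<Rightarrow> 'v set) \<Rightarrow> (nat \<Rightarrow> 'e set) \<Rightarrow> bool" where
  "matchings_avoiding G V S q \<longleftrightarrow> (\<forall>k<4. matching G (q k) \<and> covered G (q k) = V - S k)"

lemma matchings_avoidingI:
  assumes "\<And>k. k < 4 \<Longrightarrow> matching G (q k)" "\<And>k. k < 4 \<Longrightarrow> covered G (q k) = V - S k"
  shows "matchings_avoiding G V S q"
  using assms by (simp add: matchings_avoiding_def)

lemma
  assumes "matchings_avoiding G V S q" "k < 4"
  shows matchings_avoiding_matching: "matching G (q k)"
    and matchings_avoiding_covered: "covered G (q k) = V - S k"
  using assms by (simp_all add: matchings_avoiding_def)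

definition cover_count :: "(nat \<Rightarrow> 'e set) \<Rightarrow> 'e set \<Rightarrow> 'e \<Rightarrow> nat" where
  "cover_count q P e = (\<Sum>k<4. of_bool (e \<in> q k)) + of_bool (e \<in> P)"

lemma cover_count_cong:
  assumes "\<And>k. k < 4 \<Longrightarrow> e \<in> q k \<longleftrightarrow> e \<in> q' k" "e \<in> P \<longleftrightarrow> e \<in> P'"
  shows "cover_count q P e = cover_count q' P' e"
  unfolding cover_count_def using assms
  by (intro arg_cong2[where f = "(+)"] sum.cong) auto

lemma cover_count_remove2:
  assumes "i < 4" "j < 4" "i \<noteq> j"
  shows "cover_count q P e = (\<Sum>k\<in>{..<4} - {i, j}. of_bool (e \<in> q k)) + of_bool (e \<in> P) +
    of_bool (e \<in> q i) + of_bool (e \<in> q j)"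
  using assms
  by (simp add: cover_count_def sum.remove[of _ i] sum.remove[of _ j] Diff_insert2[symmetric]
      insert_commute del: sum_of_bool_eq)

context two_regular_cycle
begin

lemma cover_count_sum_at:
  assumes S: "disjoint_family_on S {..<4}" and q: "matchings_avoiding H (set vs) S q"
    and P: "matching H P" "covered H P = set vs \<inter> (\<Union>k<4. S k)"
    and j: "j < length vs"
  shows "cover_count q P (es ! j) + cover_count q P (es ! (Suc j mod length vs)) = 4"
proof -
  let ?k = "Suc j mod length vs"
  have v: "vs ! ?k \<in> set vs"
    using Suc_mod_less[OF j] by simp
  have "cover_count q P (es ! j) + cover_count q P (es ! ?k) =
      (\<Sum>k<4. of_bool (es ! j \<in> q k) + of_bool (es ! ?k \<in> q k)) +
      (of_bool (es ! j \<in> P) + of_bool (es ! ?k \<in> P))"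
    by (simp add: cover_count_def sum.distrib)
  also have "\<dots> = (\<Sum>k<4. of_bool (vs ! ?k \<in> covered H (q k))) + of_bool (vs ! ?k \<in> covered H P)"
    by (intro arg_cong2[where f = "(+)"] sum.cong refl of_bool_sum_at[OF _ j] P(1)
        matchings_avoiding_matching[OF q]) simp
  also have "\<dots> = (\<Sum>k<4. of_bool (vs ! ?k \<notin> S k)) + (\<Sum>k<4. of_bool (vs ! ?k \<in> S k))"
    using matchings_avoiding_covered[OF q] P(2) v sum_of_bool_disjoint_family[OF _ S] by simp
  also have "\<dots> = (\<Sum>k<4::nat. 1)"
    unfolding sum.distrib[symmetric] by (intro sum.cong) auto
  finally show ?thesis by simp
qed

lemma odd_cycle_cover_count:
  assumes "odd (length vs)"
    and "disjoint_family_on S {..<4}" "matchings_avoiding H (set vs) S q"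
    and "matching H P" "covered H P = set vs \<inter> (\<Union>k<4. S k)"
    and "e \<in> set es"
  shows "cover_count q P e = 2"
  using odd_alternating_sum[OF assms(1) cover_count_sum_at[OF assms(2-5)] assms(6)] by simp

text \<open>The matchings \<open>q Z\<close> and \<open>q W\<close> cover the whole cycle, so each may be replaced by either of the
  two alternating classes.\<close>

lemma even_cycle_rebalance:
  assumes ev: "even (length vs)"
    and S: "disjoint_family_on S {..<4}" and q: "matchings_avoiding H (set vs) S q"
    and P: "matching H P" "covered H P = set vs \<inter> (\<Union>k<4. S k)"
    and ZW: "Z < 4" "W < 4" "Z \<noteq> W" "set vs \<inter> S Z = {}" "set vs \<inter> S W = {}"
  obtains q' where "matchings_avoiding H (set vs) S q'"
    "\<And>e. e \<in> set es \<Longrightarrow> cover_count q' P e = 2"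
proof -
  define y where "y e = (\<Sum>k\<in>{..<4} - {Z, W}. of_bool (e \<in> q k)) + (of_bool (e \<in> P) :: nat)" for e
  have full: "set vs - S k = set vs" if "k \<in> {Z, W}" for k
    using that ZW(4,5) by blast
  have "y (es ! j) + y (es ! (Suc j mod length vs)) = 2" if j: "j < length vs" for j
  proof -
    have "of_bool (es ! j \<in> q k) + of_bool (es ! (Suc j mod length vs) \<in> q k) = (1 :: nat)"
      if k: "k \<in> {Z, W}" for k
    proof -
      have "k < 4"
        using k ZW(1,2) by auto
      then show ?thesis
        using of_bool_sum_at[OF matchings_avoiding_matching[OF q] j, of k] Suc_mod_less[OF j]
        by (simp add: matchings_avoiding_covered[OF q] full[OF k])
    qed
    from this[of Z] this[of W] show ?thesis
      using cover_count_sum_at[OF S q P j] unfolding cover_count_remove2[OF ZW(1-3)] y_def by simp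
  qed
  then obtain b c where bc: "\<And>e. e \<in> set es \<Longrightarrow>
      y e + of_bool (e \<in> parity_class b) + of_bool (e \<in> parity_class c) = 2"
    using parity_class_balance by blast
  define q' where "q' = q(Z := parity_class b, W := parity_class c)"
  show ?thesis
  proof (rule that[of q'])
    show "matchings_avoiding H (set vs) S q'"
      using q full matching_parity_class[OF ev] covered_parity_class[OF ev]
      by (simp add: matchings_avoiding_def q'_def)
    fix e assume "e \<in> set es"
    moreover have "(\<Sum>k\<in>{..<4} - {Z, W}. of_bool (e \<in> q' k)) =
        (\<Sum>k\<in>{..<4} - {Z, W}. of_bool (e \<in> q k) :: nat)"
      by (intro sum.cong) (auto simp: q'_def)
    ultimately show "cover_count q' P e = 2"
      using bc[of e] ZW(3) unfolding cover_count_remove2[OF ZW(1-3)] y_def by (simp add: q'_def)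
  qed
qed

end

section \<open>F-families\<close>

lemma ex_fulkerson_coveringI:
  fixes R :: "nat \<Rightarrow> 'e set"
  assumes R: "\<And>k. k < 4 \<Longrightarrow> perfect_matching G (R k)"
    and P: "perfect_matching G P" and P': "perfect_matching G P'"
    and count: "\<And>e. e \<in> edges G \<Longrightarrow>
      cover_count R P e + of_bool (e \<in> P') = 2"
  shows "\<exists>P. fulkerson_covering G P"
proof
  define S where "S i = (if i < 4 then R i else if i = 4 then P else P')" for i :: nat
  have "card {i. i < 6 \<and> e \<in> S i} = 2" if "e \<in> edges G" for e
  proof -
    have "card {i. i < 6 \<and> e \<in> S i} = (\<Sum>i<6. of_bool (e \<in> S i))"
      by (simp add: Collect_conj_eq lessThan_def[symmetric])
    also have "\<dots> = cover_count S (S 4) e + of_bool (e \<in> S 5)"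
    proof -
      have "{..<6::nat} = insert 5 (insert 4 {..<4})" by auto
      then show ?thesis by (simp add: cover_count_def del: sum_of_bool_eq)
    qed
    also have "cover_count S (S 4) e = cover_count R P e"
      by (rule cover_count_cong) (simp_all add: S_def)
    also have "\<dots> + of_bool (e \<in> S 5) = 2"
      using count[OF that] by (simp add: S_def)
    finally show ?thesis .
  qed
  then show "fulkerson_covering G S"
    using R P P' by (simp add: fulkerson_covering_def S_def)
qed

locale indexed_F_family =
  fixes G :: "('v, 'e) graph" and M :: "'e set" and MX :: "nat \<Rightarrow> 'e set"
  assumes wf_G: "wf_graph G" and cubic: "cubic G" and perfect_matching_M: "perfect_matching G M"
    and perfect_matching_MX: "\<And>k. k < 4 \<Longrightarrow> perfect_matching G (MX k)"
    and disjoint_members: "disjoint_family_on (\<lambda>k. M \<inter> MX k) {..<4}"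
    and card_odd_cycle: "\<And>vs es k. is_cycle (delete_edges G M) vs es \<Longrightarrow> odd (length vs) \<Longrightarrow> k < 4 \<Longrightarrow>
      card (set vs \<inter> covered G (M \<inter> MX k)) = 1"
    and card_even_cycle: "\<And>vs es. is_cycle (delete_edges G M) vs es \<Longrightarrow> even (length vs) \<Longrightarrow>
      card (set vs \<inter> covered G (\<Union>k<4. M \<inter> MX k)) \<le> 4"
    and induced_perfect_matching: "\<And>vs es. is_cycle (delete_edges G M) vs es \<Longrightarrow>
      \<exists>N. perfect_matching (induced_subgraph G (set vs \<inter> covered G (\<Union>k<4. M \<inter> MX k))) N"
begin

abbreviation H :: "('v, 'e) graph" where
  "H \<equiv> delete_edges G M"

abbreviation X :: "nat \<Rightarrow> 'e set" where
  "X k \<equiv> M \<inter> MX k"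

abbreviation U :: "'e set" where
  "U \<equiv> \<Union>k<4. X k"

lemma two_regular_H: "two_regular H"
  using wf_G cubic perfect_matching_M by (rule two_regular_delete_perfect_matching)

lemma Union_cycle_sets: "\<Union>(cycle_sets H) = verts G"
  using partition_onD1[OF partition_on_cycle_sets[OF two_regular_H]] by simp

lemma cycle_sets_eqI: "V \<in> cycle_sets H \<Longrightarrow> W \<in> cycle_sets H \<Longrightarrow> v \<in> V \<Longrightarrow> v \<in> W \<Longrightarrow> V = W"
  using disjointD[OF partition_onD2[OF partition_on_cycle_sets[OF two_regular_H]]] by blast

lemma matching_UN_cycle_sets:
  assumes "\<And>V. V \<in> cycle_sets H \<Longrightarrow> matching G (f V)" "\<And>V. V \<in> cycle_sets H \<Longrightarrow> covered G (f V) \<subseteq> V"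
  shows "matching G (\<Union>V\<in>cycle_sets H. f V)"
proof (rule matching_UN[OF assms(1)])
  show "disjoint_family_on (\<lambda>V. covered G (f V)) (cycle_sets H)"
    unfolding disjoint_family_on_def using assms(2) cycle_sets_eqI by blast
qed

lemma mem_UN_cycle_sets_iff:
  assumes "\<And>V. V \<in> cycle_sets H \<Longrightarrow> covered G (f V) \<subseteq> V" "V \<in> cycle_sets H" "v \<in> V" "v \<in> ends G e"
  shows "e \<in> (\<Union>W\<in>cycle_sets H. f W) \<longleftrightarrow> e \<in> f V"
proof
  assume "e \<in> (\<Union>W\<in>cycle_sets H. f W)"
  then obtain W where W: "W \<in> cycle_sets H" "e \<in> f W" by blast
  then have "v \<in> W"
    using assms(1)[OF W(1)] assms(4) by (auto simp: covered_def)
  then show "e \<in> f V"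
    using cycle_sets_eqI[OF assms(2) W(1) assms(3)] W(2) by simp
qed (use assms(2) in blast)

lemma matching_M: "matching G M" and covered_M: "covered G M = verts G"
  using perfect_matching_M by (simp_all add: perfect_matching_iff[OF wf_G])

lemma matching_MX: "k < 4 \<Longrightarrow> matching G (MX k)"
  and covered_MX: "k < 4 \<Longrightarrow> covered G (MX k) = verts G"
  using perfect_matching_MX by (simp_all add: perfect_matching_iff[OF wf_G])

lemma mem_U_if_covered:
  assumes "e \<in> M" "v \<in> ends G e" "v \<in> covered G U"
  shows "e \<in> U"
  using assms matching_eqI[OF matching_M assms(1)] by (auto simp: covered_def)

lemma N_exists:
  obtains N where "matching G N" "covered G N = covered G U"
    "\<And>V. V \<in> cycle_sets H \<Longrightarrow> edge_closed G N V"
proof -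
  have "\<exists>N. matching G N \<and> covered G N = V \<inter> covered G U" if V: "V \<in> cycle_sets H" for V
  proof -
    obtain vs es where "is_cycle H vs es" "V = set vs"
      using V by (auto simp: cycle_sets_def)
    moreover have "verts G \<inter> (V \<inter> covered G U) = V \<inter> covered G U"
      using V Union_cycle_sets by blast
    ultimately show ?thesis
      using induced_perfect_matching by (metis perfect_matching_induced_iff[OF wf_G])
  qed
  then obtain f where f: "\<And>V. V \<in> cycle_sets H \<Longrightarrow> matching G (f V)"
      "\<And>V. V \<in> cycle_sets H \<Longrightarrow> covered G (f V) = V \<inter> covered G U"
    by metis
  then have f_sub: "\<And>V. V \<in> cycle_sets H \<Longrightarrow> covered G (f V) \<subseteq> V" by simp
  show ?thesis
  proof (rule that)
    show "matching G (\<Union>V\<in>cycle_sets H. f V)"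
      using f(1) f_sub by (rule matching_UN_cycle_sets)
    have "covered G U \<subseteq> verts G"
      using covered_mono[of U M G] covered_M by auto
    then show "covered G (\<Union>V\<in>cycle_sets H. f V) = covered G U"
      using f(2) Union_cycle_sets by (auto simp: covered_UN)
    fix V assume V: "V \<in> cycle_sets H"
    have "ends G e \<subseteq> V" if "e \<in> (\<Union>V\<in>cycle_sets H. f V)" "v \<in> ends G e" "v \<in> V" for e v
    proof -
      have "e \<in> f V"
        using that(1) mem_UN_cycle_sets_iff[OF f_sub V that(3,2)] by blast
      then show ?thesis
        using f_sub[OF V] by (auto simp: covered_def)
    qed
    then show "edge_closed G (\<Union>V\<in>cycle_sets H. f V) V"
      unfolding edge_closed_def by blast
  qed
qed

end

locale F_family_with_N = indexed_F_family G M MX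
  for G :: "('v, 'e) graph" and M :: "'e set" and MX :: "nat \<Rightarrow> 'e set" +
  fixes N :: "'e set"
  assumes matching_N: "matching G N" and covered_N: "covered G N = covered G U"
    and edge_closed_N: "\<And>V. V \<in> cycle_sets H \<Longrightarrow> edge_closed G N V"
begin

abbreviation residual :: "nat \<Rightarrow> 'e set" where
  "residual k \<equiv> X k - N"

abbreviation blocked :: "nat \<Rightarrow> 'v set" where
  "blocked k \<equiv> covered G (residual k)"

lemma N_Int_M: "N \<inter> M = U \<inter> N"
proof
  show "N \<inter> M \<subseteq> U \<inter> N"
  proof safe
    fix e assume e: "e \<in> N" "e \<in> M"
    then obtain v where v: "v \<in> ends G e"
      using wf_graph_ends(4)[OF wf_G, of e] matching_edges[OF matching_N] by blast
    then have "v \<in> covered G N"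
      using e(1) by (auto simp: covered_def)
    then have "v \<in> covered G U"
      by (simp only: covered_N)
    then show "e \<in> U"
      using mem_U_if_covered e(2) v by blast
  qed
qed auto

lemma disjoint_blocked: "disjoint_family_on blocked {..<4}"
proof -
  have "blocked k \<inter> blocked l = {}" if "k < 4" "l < 4" "k \<noteq> l" for k l
    using disjoint_members that
    by (intro covered_Int_disjoint[OF matching_M]) (auto simp: disjoint_family_on_def)
  then show ?thesis
    by (auto simp: disjoint_family_on_def)
qed

lemma UN_blocked: "(\<Union>k<4. blocked k) = covered G (N - M)"
proof -
  have "(\<Union>k<4. blocked k) = covered G (U - U \<inter> N)"
    by (auto simp: covered_def)
  also have "\<dots> = covered G U - covered G (U \<inter> N)"
    by (intro covered_Diff matching_subset[OF matching_M]) auto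
  also have "\<dots> = covered G (N - N \<inter> M)"
    unfolding N_Int_M by (subst covered_Diff[OF matching_N]) (auto simp: covered_N)
  finally show ?thesis
    by (simp add: Diff_Int)
qed

end

locale F_family_cycle = F_family_with_N G M MX N + two_regular_cycle "delete_edges G M" vs es
  for G :: "('v, 'e) graph" and M :: "'e set" and MX :: "nat \<Rightarrow> 'e set" and N :: "'e set"
    and vs :: "'v list" and es :: "'e list"
begin

lemma edge_closed_N_set_vs: "edge_closed G N (set vs)"
  using edge_closed_N cycle by (auto simp: cycle_sets_def)

definition cycle_N :: "'e set" where
  "cycle_N = {e \<in> N - M. ends G e \<subseteq> set vs}"

definition cycle_MX :: "nat \<Rightarrow> 'e set" where
  "cycle_MX k = {e \<in> MX k - residual k. ends G e \<subseteq> set vs}"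

lemma matching_cycle_N: "matching H cycle_N"
  using matching_subset[OF matching_N] by (auto simp: cycle_N_def matching_delete_edges)

lemma covered_cycle_N: "covered G cycle_N = set vs \<inter> (\<Union>k<4. blocked k)"
proof -
  have "edge_closed G (N - M) (set vs)"
    using edge_closed_N_set_vs by (auto simp: edge_closed_def)
  then show ?thesis
    unfolding cycle_N_def UN_blocked by (rule covered_edges_within)
qed

lemma matching_cycle_MX: "k < 4 \<Longrightarrow> matching G (cycle_MX k)"
  by (rule matching_subset[OF matching_MX]) (auto simp: cycle_MX_def)

lemma covered_cycle_MX:
  assumes k: "k < 4"
  shows "covered G (cycle_MX k) = set vs - blocked k"
proof -
  have "MX k - residual k \<subseteq> edges H \<union> N"
    using matching_edges[OF matching_MX[OF k]] by auto
  then have "edge_closed G (MX k - residual k) (set vs)"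
    using edge_closed_N_set_vs edge_closed_set_vs
    unfolding edge_closed_def ends_delete_edges by blast
  then have "covered G (cycle_MX k) = set vs \<inter> covered G (MX k - residual k)"
    unfolding cycle_MX_def by (rule covered_edges_within)
  also have "\<dots> = set vs - blocked k"
    using set_vs_verts covered_MX[OF k] by (subst covered_Diff[OF matching_MX[OF k]]) auto
  finally show ?thesis .
qed

lemma even_card_blocked:
  assumes "even (length vs)" "k < 4"
  shows "even (card (set vs \<inter> blocked k))"
proof -
  have "card (set vs) = card (set vs \<inter> blocked k) + card (set vs - blocked k)"
    using card_Int_Diff[of "set vs"] by simp
  moreover have "even (card (set vs - blocked k))"
    using card_covered[OF wf_G matching_cycle_MX] covered_cycle_MX assms(2) by (metis dvd_triv_left)
  moreover have "card (set vs) = length vs"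
    using cycle by (simp add: is_cycle_def distinct_card)
  ultimately show ?thesis
    using assms(1) by presburger
qed

lemma odd_cycle_no_chord:
  assumes "odd (length vs)" "e \<in> N \<inter> M"
  shows "\<not> ends G e \<subseteq> set vs"
proof
  assume sub: "ends G e \<subseteq> set vs"
  obtain k where k: "k < 4" "e \<in> X k"
    using assms(2) N_Int_M by blast
  then have "ends G e \<subseteq> set vs \<inter> covered G (X k)"
    using sub by (auto simp: covered_def)
  then have "card (ends G e) \<le> card (set vs \<inter> covered G (X k))"
    by (intro card_mono) auto
  moreover have "card (ends G e) = 2"
    using wf_graph_ends(2)[OF wf_G] matching_edges[OF matching_N] assms(2) by blast
  ultimately show False
    using card_odd_cycle[OF cycle assms(1) k(1)] by simp
qed

lemma card_cycle_N_le_1_if_chord: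
  assumes ev: "even (length vs)" and e: "e \<in> N \<inter> M" "ends G e \<subseteq> set vs"
  shows "card cycle_N \<le> 1"
proof -
  have sub: "cycle_N \<union> {e} \<subseteq> N"
    using e(1) by (auto simp: cycle_N_def)
  then have "matching G (cycle_N \<union> {e})"
    by (rule matching_subset[OF matching_N])
  then have "2 * card (cycle_N \<union> {e}) = card (covered G (cycle_N \<union> {e}))"
    by (rule card_covered[OF wf_G, symmetric])
  also have "\<dots> \<le> card (set vs \<inter> covered G U)"
    using covered_mono[OF sub, of G] covered_N e(2)
    by (intro card_mono) (auto simp: covered_def cycle_N_def)
  also have "\<dots> \<le> 4"
    using card_even_cycle[OF cycle ev] .
  finally have "card (cycle_N \<union> {e}) \<le> 2" by simp
  moreover have "finite cycle_N" "e \<notin> cycle_N"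
    using matching_edges[OF matching_cycle_N] wf_G e(1) finite_subset
    by (auto simp: wf_graph_def cycle_N_def)
  ultimately show ?thesis by simp
qed

text \<open>If \<open>N\<close> uses a chord of the cycle, then at most one edge of \<open>N\<close> lies on the cycle, and by
  parity its two ends belong to the same member.\<close>

lemma chord_matchings:
  assumes ev: "even (length vs)" and e: "e \<in> N \<inter> M" "ends G e \<subseteq> set vs"
  obtains q where "matchings_avoiding H (set vs) blocked q"
proof -
  have card_le_1: "card cycle_N \<le> 1"
    using assms by (rule card_cycle_N_le_1_if_chord)
  have cycle_N_subset: "cycle_N \<subseteq> set es"
    using matching_edges[OF matching_cycle_N] by (auto simp: set_es_eq cycle_N_def)
  then obtain b where b: "cycle_N \<subseteq> parity_class b"
    using subset_parity_class card_le_1 by blast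
  have cases: "set vs \<inter> blocked k = {} \<or> set vs \<inter> blocked k = covered G cycle_N"
    if k: "k < 4" for k
  proof -
    have sub: "set vs \<inter> blocked k \<subseteq> covered G cycle_N"
      using covered_cycle_N k by blast
    have fin: "finite (covered G cycle_N)"
      using covered_cycle_N by simp
    have "card (covered G cycle_N) = 2 * card cycle_N"
      using card_covered[OF wf_G, of cycle_N] matching_cycle_N by (simp add: matching_delete_edges)
    then have "card (set vs \<inter> blocked k) = 0 \<or>
        card (set vs \<inter> blocked k) = card (covered G cycle_N)"
      using even_card_blocked[OF ev k] card_mono[OF fin sub] card_le_1 by presburger
    then show ?thesis
      using card_subset_eq[OF fin sub] by auto
  qed
  define q where
    "q k = (if set vs \<inter> blocked k = {} then parity_class b else parity_class b - cycle_N)" for k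
  show ?thesis
  proof (rule that[OF matchings_avoidingI])
    fix k :: nat assume k: "k < 4"
    show "matching H (q k)"
      using matching_parity_class[OF ev] by (auto simp: q_def intro: matching_subset)
    show "covered H (q k) = set vs - blocked k"
      using cases[OF k] covered_parity_class[OF ev] covered_Diff[OF matching_parity_class[OF ev] b]
      by (auto simp: q_def)
  qed
qed

lemma cycle_matchings:
  obtains q where "matchings_avoiding H (set vs) blocked q"
proof (cases "\<exists>e \<in> N \<inter> M. ends G e \<subseteq> set vs")
  case True
  then show ?thesis
    using chord_matchings odd_cycle_no_chord that by metis
next
  case False
  show ?thesis
  proof (rule that[OF matchings_avoidingI])
    fix k :: nat assume k: "k < 4"
    have "cycle_MX k \<inter> M = {}"
      using False by (auto simp: cycle_MX_def)
    then show "matching H (cycle_MX k)"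
      using matching_cycle_MX[OF k] by (simp add: matching_delete_edges)
    show "covered H (cycle_MX k) = set vs - blocked k"
      using covered_cycle_MX[OF k] by simp
  qed
qed

lemma even_cycle_two_members_avoid:
  assumes ev: "even (length vs)"
  obtains Z W where "Z < 4" "W < 4" "Z \<noteq> W"
    "set vs \<inter> blocked Z = {}" "set vs \<inter> blocked W = {}"
proof -
  define S where "S k = set vs \<inter> blocked k" for k
  define I where "I = {k \<in> {..<4}. S k \<noteq> {}}"
  have "2 \<le> card (S k)" if "k \<in> I" for k
  proof -
    have "even (card (S k))" "card (S k) \<noteq> 0"
      using that even_card_blocked[OF ev] by (auto simp: I_def S_def)
    then show ?thesis by presburger
  qed
  then have "card I * 2 \<le> (\<Sum>k\<in>I. card (S k))"
    using sum_bounded_below[of I 2 "\<lambda>k. card (S k)"] by simp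
  also have "\<dots> = card (\<Union>k\<in>I. S k)"
    using disjoint_blocked
    by (intro card_UN_disjoint[symmetric]) (auto simp: I_def S_def disjoint_family_on_def)
  also have "\<dots> \<le> card (set vs \<inter> covered G U)"
    by (intro card_mono) (auto simp: I_def S_def covered_def)
  also have "\<dots> \<le> 4"
    using card_even_cycle[OF cycle ev] .
  finally have "card ({..<4} - I) \<ge> 2"
    by (subst card_Diff_subset) (auto simp: I_def)
  then obtain Z W where "Z \<in> {..<4} - I" "W \<in> {..<4} - I" "Z \<noteq> W"
    by (auto simp: card_le_Suc_iff numeral_eq_Suc)
  then show ?thesis
    using that by (auto simp: I_def S_def)
qed

lemma cycle_double_cover:
  obtains q where "matchings_avoiding H (set vs) blocked q"
    "\<And>e. e \<in> set es \<Longrightarrow> cover_count q N e = 2"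
proof -
  have cycle_N: "matching H cycle_N" "covered H cycle_N = set vs \<inter> (\<Union>k<4. blocked k)"
    using matching_cycle_N covered_cycle_N by simp_all
  obtain q where q: "matchings_avoiding H (set vs) blocked q"
    by (rule cycle_matchings)
  obtain q' where q': "matchings_avoiding H (set vs) blocked q'"
    and count: "\<And>e. e \<in> set es \<Longrightarrow> cover_count q' cycle_N e = 2"
  proof (cases "even (length vs)")
    case True
    then obtain Z W where "Z < 4" "W < 4" "Z \<noteq> W"
        "set vs \<inter> blocked Z = {}" "set vs \<inter> blocked W = {}"
      by (rule even_cycle_two_members_avoid)
    then show ?thesis
      using even_cycle_rebalance[OF True disjoint_blocked q cycle_N] that by blast
  next
    case False
    then show ?thesis
      using odd_cycle_cover_count[OF False disjoint_blocked q cycle_N] that[OF q] by blast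
  qed
  have "cover_count q' N e = 2" if "e \<in> set es" for e
  proof -
    have "e \<in> cycle_N \<longleftrightarrow> e \<in> N"
      using that by (auto simp: cycle_N_def set_es_eq)
    then show ?thesis
      using count[OF that] cover_count_cong[of e q' q' cycle_N N] by simp
  qed
  with q' show ?thesis
    by (rule that)
qed

end

context F_family_with_N
begin

lemma cycle_sets_double_cover:
  assumes V: "V \<in> cycle_sets H"
  shows "\<exists>q. matchings_avoiding H V blocked q \<and>
    (\<forall>e\<in>edges H. ends G e \<subseteq> V \<longrightarrow> cover_count q N e = 2)"
proof -
  obtain vs es where cycle: "is_cycle H vs es" and V_eq: "V = set vs"
    using V by (auto simp: cycle_sets_def)
  interpret F_family_cycle G M MX N vs es
    by unfold_locales (rule two_regular_H cycle)+
  obtain q where "matchings_avoiding H (set vs) blocked q"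
      "\<And>e. e \<in> set es \<Longrightarrow> cover_count q N e = 2"
    using cycle_double_cover by blast
  then show ?thesis
    by (intro exI[of _ q]) (auto simp: set_es_eq V_eq)
qed

lemma double_cover_outside_M:
  obtains Q where "matchings_avoiding H (verts G) blocked Q"
    "\<And>e. e \<in> edges H \<Longrightarrow> cover_count Q N e = 2"
proof -
  obtain q where q: "\<And>V. V \<in> cycle_sets H \<Longrightarrow> matchings_avoiding H V blocked (q V)"
    and count: "\<And>V e. V \<in> cycle_sets H \<Longrightarrow> e \<in> edges H \<Longrightarrow> ends G e \<subseteq> V \<Longrightarrow> cover_count (q V) N e = 2"
    using cycle_sets_double_cover by metis
  have matching_q: "matching G (q V k)" "q V k \<inter> M = {}" if "V \<in> cycle_sets H" "k < 4" for V k
    using matchings_avoiding_matching[OF q[OF that(1)] that(2)]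
    by (simp_all add: matching_delete_edges)
  have covered_q: "covered G (q V k) = V - blocked k" if "V \<in> cycle_sets H" "k < 4" for V k
    using matchings_avoiding_covered[OF q[OF that(1)] that(2)] by simp
  define Q where "Q k = (\<Union>V\<in>cycle_sets H. q V k)" for k
  show ?thesis
  proof (rule that[of Q], rule matchings_avoidingI)
    fix k :: nat assume k: "k < 4"
    have "matching G (Q k)"
      unfolding Q_def using matching_q(1) covered_q k by (intro matching_UN_cycle_sets) auto
    then show "matching H (Q k)"
      using matching_q(2) k by (auto simp: matching_delete_edges Q_def)
    show "covered H (Q k) = verts G - blocked k"
      using covered_q k Union_cycle_sets by (auto simp: Q_def covered_UN)
  next
    fix e assume e: "e \<in> edges H"
    then obtain v where v: "v \<in> ends G e" "v \<in> verts G"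
      using wf_graph_ends(1,4)[OF wf_G, of e] by auto
    then obtain V where V: "V \<in> cycle_sets H" "v \<in> V"
      using Union_cycle_sets by blast
    have "cover_count Q N e = cover_count (q V) N e"
      unfolding Q_def using covered_q
      by (intro cover_count_cong refl mem_UN_cycle_sets_iff[OF _ V v(1)]) auto
    moreover have "ends G e \<subseteq> V"
      using edge_closedD[OF edge_closed_cycle_sets[OF two_regular_H V(1)] e] v(1) V(2) by simp
    ultimately show "cover_count Q N e = 2"
      using count[OF V(1) e] by simp
  qed
qed

lemma perfect_matching_swap_N: "perfect_matching G (M - U \<union> N)"
  unfolding perfect_matching_iff[OF wf_G]
proof
  have M_U: "covered G (M - U) = verts G - covered G U"
    using covered_M by (subst covered_Diff[OF matching_M]) auto
  show "matching G (M - U \<union> N)"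
    using M_U covered_N by (intro matching_Un matching_N matching_subset[OF matching_M]) auto
  show "covered G (M - U \<union> N) = verts G"
    using M_U covered_N covered_M covered_mono[of U M G] by (auto simp: covered_Un)
qed

lemma perfect_matching_residual_Un:
  assumes "matching G Q" "covered G Q = verts G - blocked k"
  shows "perfect_matching G (residual k \<union> Q)"
  unfolding perfect_matching_iff[OF wf_G]
proof
  show "matching G (residual k \<union> Q)"
    using assms by (intro matching_Un assms(1) matching_subset[OF matching_M, of "residual k"]) auto
  show "covered G (residual k \<union> Q) = verts G"
    using assms(2) covered_M covered_mono[of "residual k" M G] by (auto simp: covered_Un)
qed

lemma sum_of_bool_residual: "(\<Sum>k<4. of_bool (e \<in> residual k)) = (of_bool (e \<in> U - N) :: nat)"
proof -
  have "disjoint_family_on residual {..<4}"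
    using disjoint_members by (auto simp: disjoint_family_on_def)
  then have "(\<Sum>k<4. of_bool (e \<in> residual k)) = (of_bool (e \<in> (\<Union>k<4. residual k)) :: nat)"
    by (intro sum_of_bool_disjoint_family) simp_all
  also have "(\<Union>k<4. residual k) = U - N" by auto
  finally show ?thesis .
qed

lemma fulkerson_covering_exists: "\<exists>P. fulkerson_covering G P"
proof -
  obtain Q where Q: "matchings_avoiding H (verts G) blocked Q"
    and count: "\<And>e. e \<in> edges H \<Longrightarrow> cover_count Q N e = 2"
    using double_cover_outside_M by blast
  have Q_M: "matching G (Q k)" "Q k \<inter> M = {}" if "k < 4" for k
    using matchings_avoiding_matching[OF Q that] by (simp_all add: matching_delete_edges)
  show ?thesis
  proof (rule ex_fulkerson_coveringI)
    fix k :: nat assume "k < 4"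
    then show "perfect_matching G (residual k \<union> Q k)"
      using Q_M matchings_avoiding_covered[OF Q] by (intro perfect_matching_residual_Un) simp_all
  next
    fix e assume e: "e \<in> edges G"
    show "cover_count (\<lambda>k. residual k \<union> Q k) (M - U \<union> N) e + of_bool (e \<in> M) = 2"
    proof (cases "e \<in> M")
      case True
      then have "cover_count (\<lambda>k. residual k \<union> Q k) (M - U \<union> N) e =
          cover_count residual (M - U \<union> N) e"
        using Q_M(2) by (intro cover_count_cong) auto
      moreover have "e \<in> N \<Longrightarrow> e \<in> U"
        using N_Int_M True by blast
      ultimately show ?thesis
        using True sum_of_bool_residual[of e]
        by (auto simp: cover_count_def simp del: sum_of_bool_eq)
    next
      case False
      then have "cover_count (\<lambda>k. residual k \<union> Q k) (M - U \<union> N) e = cover_count Q N e"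
        by (intro cover_count_cong) auto
      then show ?thesis
        using count[of e] e False by simp
    qed
  qed (rule perfect_matching_M perfect_matching_swap_N)+
qed

end

lemma F_family_odd_cycle:
  assumes "F_family G M A B C D" "is_cycle (delete_edges G M) vs es" "odd (length vs)"
    "X \<in> {A, B, C, D}"
  shows "card (set vs \<inter> covered G X) = 1"
  using assms by (auto simp: F_family_def)

lemma F_family_even_cycle:
  assumes "F_family G M A B C D" "is_cycle (delete_edges G M) vs es" "even (length vs)"
  shows "card (set vs \<inter> covered G (A \<union> B \<union> C \<union> D)) \<le> 4"
proof (cases "set vs \<inter> covered G (A \<union> B \<union> C \<union> D) = {}")
  case False
  then have "card (set vs \<inter> covered G (A \<union> B \<union> C \<union> D)) = 4"
    using assms by (auto simp: F_family_def)
  then show ?thesis by simp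
qed simp

lemma F_family_induced_perfect_matching:
  assumes "F_family G M A B C D" "is_cycle (delete_edges G M) vs es"
  shows "\<exists>N. perfect_matching (induced_subgraph G (set vs \<inter> covered G (A \<union> B \<union> C \<union> D))) N"
proof (cases "set vs \<inter> covered G (A \<union> B \<union> C \<union> D) = {}")
  case True
  then show ?thesis
    by (intro exI[of _ "{}"]) (simp add: perfect_matching_def induced_subgraph_def)
next
  case False
  then show ?thesis
    using assms by (auto simp: F_family_def)
qed

lemma all_less_four: "(\<forall>k<4::nat. Q k) \<longleftrightarrow> Q 0 \<and> Q 1 \<and> Q 2 \<and> Q 3"
  by (auto simp: numeral_eq_Suc All_less_Suc)

lemma F_family_indexed:
  assumes "wf_graph G" "cubic G" "perfect_matching G M" and F: "F_family G M A B C D"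
  obtains MX where "indexed_F_family G M MX"
proof -
  have "\<forall>X\<in>{A, B, C, D}. balanced_matching G M X"
    using F by (simp add: F_family_def)
  then obtain MA MB MC MD where pm: "perfect_matching G MA" "perfect_matching G MB"
      "perfect_matching G MC" "perfect_matching G MD"
    and eqs: "A = M \<inter> MA" "B = M \<inter> MB" "C = M \<inter> MC" "D = M \<inter> MD"
    by (auto simp: balanced_matching_def)
  define MX where "MX k = [MA, MB, MC, MD] ! k" for k
  have members: "M \<inter> MX 0 = A" "M \<inter> MX 1 = B" "M \<inter> MX 2 = C" "M \<inter> MX 3 = D"
    by (simp_all add: MX_def eqs)
  have four: "{..<4::nat} = {0, 1, 2, 3}" by auto
  have U: "(\<Union>k<4. M \<inter> MX k) = A \<union> B \<union> C \<union> D"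
    unfolding four by (simp add: members[simplified] Un_assoc)
  have "indexed_F_family G M MX"
  proof
    show "wf_graph G" "cubic G" "perfect_matching G M"
      by fact+
    show "perfect_matching G (MX k)" if "k < 4" for k
      using that all_less_four[of "\<lambda>k. perfect_matching G (MX k)"] pm by (simp add: MX_def)
    have "\<forall>k<4. \<forall>l<4. k \<noteq> l \<longrightarrow> (M \<inter> MX k) \<inter> (M \<inter> MX l) = {}"
      unfolding all_less_four members using F by (auto simp: F_family_def)
    then show "disjoint_family_on (\<lambda>k. M \<inter> MX k) {..<4}"
      by (simp add: disjoint_family_on_def)
  next
    fix vs es assume cycle: "is_cycle (delete_edges G M) vs es"
    have "\<forall>k<4. M \<inter> MX k \<in> {A, B, C, D}"
      unfolding all_less_four members by simp
    then show "card (set vs \<inter> covered G (M \<inter> MX k)) = 1" if "odd (length vs)" "k < 4" for k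
      using F_family_odd_cycle[OF F cycle] that by blast
    show "card (set vs \<inter> covered G (\<Union>k<4. M \<inter> MX k)) \<le> 4" if "even (length vs)"
      unfolding U using F_family_even_cycle[OF F cycle that] .
    show "\<exists>N. perfect_matching (induced_subgraph G (set vs \<inter> covered G (\<Union>k<4. M \<inter> MX k))) N"
      unfolding U using F_family_induced_perfect_matching[OF F cycle] .
  qed
  then show ?thesis by (rule that)
qed

theorem theorem4p1:
  fixes G :: "('v, 'e) graph" and M A B C D :: "'e set"
  assumes "wf_graph G" and "cubic G" and "bridgeless G"
    and "perfect_matching G M"
    and "F_family G M A B C D"
  shows "\<exists>P. fulkerson_covering G P"
proof -
  obtain MX where "indexed_F_family G M MX"
    using F_family_indexed assms(1,2,4,5) by blast
  then interpret indexed_F_family G M MX .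
  obtain N where "matching G N" "covered G N = covered G U"
      "\<And>V. V \<in> cycle_sets H \<Longrightarrow> edge_closed G N V"
    using N_exists by blast
  then interpret F_family_with_N G M MX N
    by unfold_locales
  show ?thesis
    by (rule fulkerson_covering_exists)
qed

end
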